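(* Let $f:\mathbb{X}\to\mathbb{R}$ be a (finite) measurable function. If $\limsup_n B_nf<+\infty$ $\mu$-a.e. on a set of positive measure, then there is a constant $c\in\mathbb{R}\cup\{-\infty\}$ such that $$\lim_n A_n^+f=\lim_n A_n^-f=\lim_n B_nf=c\quad \mu\text{-a.e. on } \mathbb{X}.$$
   Context: Standing assumptions: $(\mathbb{X},\mathcal{X},\mu,T)$ is a probability space with $T$ an invertible, bi-measurable, measure-preserving, ergodic transformation. For measurable $f:\mathbb{X}\to\mathbb{R}$ and $n\ge1$: forward averages $A_n^+f=\frac1n\sum_{i=0}^{n-1}f\circ T^i$, backward averages $A_n^-f=\frac1n\sum_{i=0}^{n-1}f\circ T^{-i}$, and symmetric bilateral averages $B_nf=\frac{1}{2n+1}\sum_{i=-n}^{n}f\circ T^i$. *)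

theory Defs
  imports "HOL-Probability.Probability"
begin

definition Tinv :: "'a measure \<Rightarrow> ('a \<Rightarrow> 'a) \<Rightarrow> 'a \<Rightarrow> 'a" where
  "Tinv M T = the_inv_into (space M) T"

definition invertible_mpt :: "'a measure \<Rightarrow> ('a \<Rightarrow> 'a) \<Rightarrow> bool" where
  "invertible_mpt M T \<longleftrightarrow>
     T \<in> measurable M M \<and> bij_betw T (space M) (space M) \<and>
     Tinv M T \<in> measurable M M \<and>
     (\<forall>A\<in>sets M. emeasure M (T -` A \<inter> space M) = emeasure M A)"

definition ergodic :: "'a measure \<Rightarrow> ('a \<Rightarrow> 'a) \<Rightarrow> bool" where
  "ergodic M T \<longleftrightarrow>
     (\<forall>A\<in>sets M. T -` A \<inter> space M = A \<longrightarrow> measure M A = 0 \<or> measure M A = 1)"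

definition Tpow :: "'a measure \<Rightarrow> ('a \<Rightarrow> 'a) \<Rightarrow> int \<Rightarrow> 'a \<Rightarrow> 'a" where
  "Tpow M T i = (if 0 \<le> i then T ^^ nat i else Tinv M T ^^ nat (- i))"

definition fwd_avg :: "'a measure \<Rightarrow> ('a \<Rightarrow> 'a) \<Rightarrow> ('a \<Rightarrow> real) \<Rightarrow> nat \<Rightarrow> 'a \<Rightarrow> real" where
  "fwd_avg M T f n x = (\<Sum>i<n. f (Tpow M T (int i) x)) / real n"

definition bwd_avg :: "'a measure \<Rightarrow> ('a \<Rightarrow> 'a) \<Rightarrow> ('a \<Rightarrow> real) \<Rightarrow> nat \<Rightarrow> 'a \<Rightarrow> real" where
  "bwd_avg M T f n x = (\<Sum>i<n. f (Tpow M T (- int i) x)) / real n"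

definition bil_avg :: "'a measure \<Rightarrow> ('a \<Rightarrow> 'a) \<Rightarrow> ('a \<Rightarrow> real) \<Rightarrow> nat \<Rightarrow> 'a \<Rightarrow> real" where
  "bil_avg M T f n x = (\<Sum>i\<in>{- int n..int n}. f (Tpow M T i x)) / real (2 * n + 1)"

end

theory Submission
  imports Defs "HOL-Real_Asymp.Real_Asymp"
begin

text \<open>
  Let \<open>S\<^sub>n\<close> denote Birkhoff sums of \<open>g = f - K\<close>, where \<open>K\<close> is such that on a set \<open>E\<close> of positive measure all
  symmetric sums of \<open>g\<close> are nonpositive. If an orbit visits \<open>E\<close> at two times \<open>t\<^sub>1 < t\<^sub>2\<close>, two adjacent
  symmetric blocks centred there tile an interval of length \<open>2 (t\<^sub>2 - t\<^sub>1)\<close>; since the visits together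
  with boundedly many translates have density close to \<open>1\<close>, such intervals end at every large \<open>n\<close>
  and start in a bounded window. Hence \<open>sup\<^sub>n S\<^sub>n < \<infinity>\<close> almost everywhere, and likewise for \<open>T\<^sup>-\<^sup>1\<close>.

  Put \<open>h = sup\<^sub>n S\<^sub>n\<close>. Then \<open>g = h - h \<circ> T - k\<close> with \<open>k \<ge> 0\<close>. If \<open>k\<close> is integrable, the bound on the
  backward sums makes \<open>h \<circ> T\<^sup>-\<^sup>n\<close> grow at most linearly, which by density of visits forces
  \<open>h \<circ> T\<^sup>\<plusminus>\<^sup>n = o(n)\<close>, and all averages of \<open>g\<close> converge to \<open>- \<integral> k\<close>. If neither \<open>k\<close> nor its analogue for
  \<open>T\<^sup>-\<^sup>1\<close> is integrable, all averages tend to \<open>-\<infinity>\<close>.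
\<close>

section \<open>Birkhoff's theorem for ergodic maps\<close>

definition birkhoff_sum :: "('a \<Rightarrow> 'a) \<Rightarrow> ('a \<Rightarrow> real) \<Rightarrow> nat \<Rightarrow> 'a \<Rightarrow> real" where
  "birkhoff_sum T f n x = (\<Sum>i<n. f ((T ^^ i) x))"

lemma birkhoff_sum_0 [simp]: "birkhoff_sum T f 0 x = 0"
  by (simp add: birkhoff_sum_def)

lemma birkhoff_sum_Suc: "birkhoff_sum T f (Suc n) x = birkhoff_sum T f n x + f ((T ^^ n) x)"
  by (simp add: birkhoff_sum_def)

lemma birkhoff_sum_Suc_shift: "birkhoff_sum T f (Suc n) x = f x + birkhoff_sum T f n (T x)"
  unfolding birkhoff_sum_def by (subst sum.lessThan_Suc_shift) (simp add: funpow_swap1)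

lemma birkhoff_sum_diff_const:
  "birkhoff_sum T (\<lambda>x. f x - a) n x = birkhoff_sum T f n x - real n * a"
  by (simp add: birkhoff_sum_def sum_subtractf)

lemma birkhoff_sum_uminus: "birkhoff_sum T (\<lambda>x. - f x) n x = - birkhoff_sum T f n x"
  by (simp add: birkhoff_sum_def sum_negf)

text \<open>The sums at \<open>x\<close> and at \<open>T x\<close> differ by the single term
  \<open>g x\<close> and a shift of the index. Boundedness thus passes along whole orbits in both
  directions.\<close>

lemma bdd_above_birkhoff_sum_shift:
  "bdd_above (range (\<lambda>n. birkhoff_sum T g n (T x))) \<longleftrightarrow> bdd_above (range (\<lambda>n. birkhoff_sum T g n x))"
proof
  assume "bdd_above (range (\<lambda>n. birkhoff_sum T g n (T x)))"
  then obtain C where C: "birkhoff_sum T g n (T x) \<le> C" for n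
    by (auto simp: bdd_above_def)
  have "birkhoff_sum T g n x \<le> max 0 (g x + C)" for n
    using C[of "n - 1"] by (cases n) (auto simp: birkhoff_sum_Suc_shift le_max_iff_disj)
  then show "bdd_above (range (\<lambda>n. birkhoff_sum T g n x))"
    by (auto intro!: bdd_aboveI2)
next
  assume "bdd_above (range (\<lambda>n. birkhoff_sum T g n x))"
  then obtain C where C: "birkhoff_sum T g n x \<le> C" for n
    by (auto simp: bdd_above_def)
  have "birkhoff_sum T g n (T x) \<le> C - g x" for n
    using C[of "Suc n"] by (simp add: birkhoff_sum_Suc_shift)
  then show "bdd_above (range (\<lambda>n. birkhoff_sum T g n (T x)))"
    by (auto intro!: bdd_aboveI2)
qed

locale ergodic_map = prob_space M for M :: "'a measure" +
  fixes T :: "'a \<Rightarrow> 'a"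
  assumes T_measurable [measurable]: "T \<in> measurable M M"
    and T_preserving: "A \<in> sets M \<Longrightarrow> emeasure M (T -` A \<inter> space M) = emeasure M A"
    and T_ergodic: "ergodic M T"
begin

lemma funpow_measurable [measurable]: "(T ^^ n) \<in> measurable M M"
  by (induction n) auto

lemma birkhoff_sum_measurable [measurable]:
  assumes [measurable]: "f \<in> borel_measurable M"
  shows "birkhoff_sum T f n \<in> borel_measurable M"
  unfolding birkhoff_sum_def by measurable

lemma T_space: "x \<in> space M \<Longrightarrow> T x \<in> space M"
  using measurable_space[OF T_measurable] .

lemma funpow_space: "x \<in> space M \<Longrightarrow> (T ^^ n) x \<in> space M"
  using measurable_space[OF funpow_measurable] .

lemma distr_T: "distr M M T = M"
  by (rule measure_eqI) (auto simp: emeasure_distr T_preserving)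

lemma integral_T:
  fixes f :: "'a \<Rightarrow> real"
  shows "f \<in> borel_measurable M \<Longrightarrow> (\<integral>x. f (T x) \<partial>M) = (\<integral>x. f x \<partial>M)"
  using integral_distr[OF T_measurable, of f] by (simp add: distr_T)

lemma integrable_T:
  fixes f :: "'a \<Rightarrow> real"
  shows "integrable M f \<Longrightarrow> integrable M (\<lambda>x. f (T x))"
  using integrable_distr[OF T_measurable, of f] by (simp add: distr_T)

lemma prob_funpow: "A \<in> sets M \<Longrightarrow> prob ((T ^^ n) -` A \<inter> space M) = prob A"
proof (induction n arbitrary: A)
  case (Suc n)
  have "(T ^^ Suc n) -` A \<inter> space M = (T ^^ n) -` (T -` A \<inter> space M) \<inter> space M"
    using funpow_space by auto
  moreover have "T -` A \<inter> space M \<in> sets M"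
    using Suc.prems by measurable
  moreover have "prob (T -` A \<inter> space M) = prob A"
    using T_preserving[OF Suc.prems] by (simp add: measure_def)
  ultimately show ?case
    using Suc.IH by metis
qed (auto simp: sets.Int_space_eq2)

lemma invariant_cases:
  assumes [measurable]: "Measurable.pred M P"
    and inv: "\<And>x. x \<in> space M \<Longrightarrow> P (T x) \<longleftrightarrow> P x"
  obtains "AE x in M. P x" | "AE x in M. \<not> P x"
proof -
  let ?A = "{x \<in> space M. P x}"
  have A: "?A \<in> sets M" by measurable
  have "T -` ?A \<inter> space M = ?A"
    using inv T_space by auto
  then have "prob ?A = 0 \<or> prob ?A = 1"
    using T_ergodic A unfolding ergodic_def by blast
  then show thesis
  proof
    assume "prob ?A = 0"
    then have "AE x in M. x \<notin> ?A"
      using A by (simp add: prob_eq_0)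
    with AE_space have "AE x in M. \<not> P x"
      by eventually_elim simp
    then show thesis
      by (rule that(2))
  next
    assume "prob ?A = 1"
    then have "AE x in M. x \<in> ?A"
      by (rule AE_prob_1)
    then have "AE x in M. P x"
      by eventually_elim simp
    then show thesis
      by (rule that(1))
  qed
qed

text \<open>With \<open>m n\<close> the running maximum of the Birkhoff sums, \<open>m (Suc n) - m n \<circ> T\<close> has nonnegative
  integral and decreases to \<open>\<phi>\<close> wherever \<open>m\<close> is unbounded.\<close>

lemma birkhoff_sum_bdd_above:
  assumes int: "integrable M \<phi>" and neg: "(\<integral>x. \<phi> x \<partial>M) < 0"
  shows "AE x in M. bdd_above (range (\<lambda>n. birkhoff_sum T \<phi> n x))"
proof -
  note [measurable] = borel_measurable_integrable[OF int]
  \<comment> \<open>Unfolding the recursion gives \<open>m n x\<close> as the maximum of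
    \<open>birkhoff_sum T \<phi> j x\<close> over \<open>j \<le> n\<close>; the term for
    \<open>j = 0\<close> makes it nonnegative.\<close>
  define m where "m = rec_nat (\<lambda>x. 0) (\<lambda>n mn x. max 0 (\<phi> x + mn (T x)))"
  have m0: "m 0 = (\<lambda>x. 0)" and mSuc: "m (Suc n) = (\<lambda>x. max 0 (\<phi> x + m n (T x)))" for n
    by (simp_all add: m_def)
  have m_int: "integrable M (m n)" for n
  proof (induction n)
    case (Suc n)
    from integrable_T[OF this] show ?case
      unfolding mSuc using int by simp
  qed (simp add: m0)
  note [measurable] = borel_measurable_integrable[OF m_int]
  have m_nonneg: "0 \<le> m n x" for n x
    by (cases n) (auto simp: m0 mSuc)
  have m_mono: "m n x \<le> m (Suc n) x" for n x
  proof (induction n arbitrary: x)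
    case 0
    then show ?case by (simp add: m0 mSuc)
  next
    case (Suc n)
    then show ?case
      unfolding mSuc[of n] mSuc[of "Suc n"] by (intro max.mono add_left_mono) auto
  qed
  have S_le: "birkhoff_sum T \<phi> n x \<le> m n x" for n x
  proof (induction n arbitrary: x)
    case (Suc n)
    then show ?case
      by (simp add: birkhoff_sum_Suc_shift mSuc le_max_iff_disj)
  qed (simp add: m0)
  \<comment> \<open>Unboundedness of the running maximum, with natural thresholds so that
    measurability needs only countable quantifiers. It is invariant since \<open>m (Suc n) x\<close>
    and \<open>m n (T x)\<close> differ by \<open>\<phi> x\<close> up to the cut at 0.\<close>
  let ?P = "\<lambda>x. \<forall>N::nat. \<exists>n. real N < m n x"
  have P_inv: "?P (T x) \<longleftrightarrow> ?P x" for x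
  proof
    assume P: "?P (T x)"
    show "?P x"
    proof
      fix N
      obtain K :: nat where "real N - \<phi> x < real K"
        using reals_Archimedean2 by blast
      moreover obtain n where "real K < m n (T x)"
        using P by blast
      ultimately have "real N < m (Suc n) x"
        by (simp add: mSuc)
      then show "\<exists>n. real N < m n x" ..
    qed
  next
    assume P: "?P x"
    show "?P (T x)"
    proof
      fix N
      obtain K :: nat where K: "real N + \<phi> x < real K"
        using reals_Archimedean2 by blast
      obtain n where n: "real K < m n x"
        using P by blast
      then have "n \<noteq> 0"
        using m0 by (cases n) auto
      then obtain n' where "n = Suc n'"
        using not0_implies_Suc by blast
      then have "real N < m n' (T x)"
        using n K by (auto simp: mSuc less_max_iff_disj)
      then show "\<exists>n. real N < m n (T x)" ..
    qed
  qed
  consider "AE x in M. ?P x" | "AE x in M. \<not> ?P x"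
    by (rule invariant_cases[of ?P]) (use P_inv in auto)
  then show ?thesis
  proof cases
    case 1
    define d where "d = (\<lambda>n x. m (Suc n) x - m n (T x))"
    \<comment> \<open>This is \<open>\<phi> x\<close> cut off below at
      \<open>- m n (T x) \<le> 0\<close>: it is dominated by \<open>\<bar>\<phi> x\<bar>\<close> and
      equals \<open>\<phi> x\<close> as soon as \<open>m n (T x)\<close> exceeds
      \<open>- \<phi> x\<close>.\<close>
    have d: "d n x = max (- m n (T x)) (\<phi> x)" for n x
      by (auto simp: d_def mSuc)
    have "(\<lambda>n. integral\<^sup>L M (d n)) \<longlonglongrightarrow> integral\<^sup>L M \<phi>"
    proof (rule integral_dominated_convergence[where w = "\<lambda>x. \<bar>\<phi> x\<bar>"])
      show "AE x in M. (\<lambda>n. d n x) \<longlonglongrightarrow> \<phi> x"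
        using 1
      proof eventually_elim
        case (elim x)
        obtain N :: nat where N: "- \<phi> x < real N"
          using reals_Archimedean2 by blast
        obtain n0 where n0: "real N < m n0 (T x)"
          using elim P_inv by blast
        have "d n x = \<phi> x" if "n0 \<le> n" for n
          using lift_Suc_mono_le[of "\<lambda>n. m n (T x)", OF m_mono that] n0 N by (simp add: d max_def)
        then show ?case
          by (intro tendsto_eventually eventually_sequentiallyI)
      qed
      show "AE x in M. norm (d n x) \<le> \<bar>\<phi> x\<bar>" for n
      proof (rule AE_I2)
        show "norm (d n x) \<le> \<bar>\<phi> x\<bar>" for x
          using m_nonneg[of n "T x"] by (simp add: d max_def abs_real_def)
      qed
      show "d n \<in> borel_measurable M" for n
        unfolding d_def by measurable
    qed (use int in auto)
    moreover have "0 \<le> integral\<^sup>L M (d n)" for n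
    proof -
      have "integral\<^sup>L M (d n) = integral\<^sup>L M (m (Suc n)) - integral\<^sup>L M (m n)"
        unfolding d_def by (subst Bochner_Integration.integral_diff)
          (auto intro!: m_int integrable_T integral_T)
      also have "\<dots> \<ge> 0"
        using m_mono by (simp add: integral_mono m_int)
      finally show ?thesis .
    qed
    ultimately have "0 \<le> integral\<^sup>L M \<phi>"
      using LIMSEQ_le_const by blast
    then show ?thesis
      using neg by simp
  next
    case 2
    then show ?thesis
    proof eventually_elim
      case (elim x)
      then obtain N :: nat where "m n x \<le> real N" for n
        by (auto simp: not_less)
      then have "birkhoff_sum T \<phi> n x \<le> real N" for n
        using S_le order_trans by blast
      then show ?case
        by (auto intro!: bdd_aboveI2)
    qed
  qed
qed

text \<open>Subtracting \<open>a\<close> makes the integral negative. The resulting bound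
  \<open>n * a + C\<close> serves both for the upper limit of the averages and for linear growth
  estimates.\<close>

lemma birkhoff_sum_diff_bdd_above:
  assumes "integrable M \<phi>" and "(\<integral>x. \<phi> x \<partial>M) < a"
  shows "AE x in M. bdd_above (range (\<lambda>n. birkhoff_sum T \<phi> n x - real n * a))"
  using birkhoff_sum_bdd_above[of "\<lambda>x. \<phi> x - a"] assms
  by (simp add: birkhoff_sum_diff_const prob_space)

lemma birkhoff_limsup_le:
  assumes int: "integrable M \<phi>"
  shows "AE x in M. \<forall>e>0. \<forall>\<^sub>F n in sequentially. birkhoff_sum T \<phi> n x / n < (\<integral>x. \<phi> x \<partial>M) + e"
proof -
  let ?I = "\<integral>x. \<phi> x \<partial>M"
  have "AE x in M. \<forall>k::nat. bdd_above (range (\<lambda>n. birkhoff_sum T \<phi> n x - real n * (?I + 1 / Suc k)))"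
    unfolding AE_all_countable by (intro allI birkhoff_sum_diff_bdd_above int) auto
  then show ?thesis
  proof eventually_elim
    case (elim x)
    show ?case
    proof (intro allI impI)
      fix e :: real assume "e > 0"
      then obtain k where k: "1 / real (Suc k) < e"
        using nat_approx_posE by blast
      obtain C where C: "birkhoff_sum T \<phi> n x - real n * (?I + 1 / Suc k) \<le> C" for n
        using elim by (auto simp: bdd_above_def)
      have "(\<lambda>n. C / real n) \<longlonglongrightarrow> 0"
        by (rule lim_const_over_n)
      then have "\<forall>\<^sub>F n in sequentially. C / real n < e - 1 / Suc k"
        by (rule order_tendstoD(2)) (use k in simp)
      then show "\<forall>\<^sub>F n in sequentially. birkhoff_sum T \<phi> n x / n < ?I + e"
        using eventually_gt_at_top[of 0]
      proof eventually_elim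
        case (elim n)
        have "birkhoff_sum T \<phi> n x / n \<le> (C + real n * (?I + 1 / Suc k)) / n"
          using C[of n] by (intro divide_right_mono) auto
        also have "\<dots> = C / n + (?I + 1 / Suc k)"
          using elim by (simp add: field_simps)
        finally show ?case
          using elim by simp
      qed
    qed
  qed
qed

text \<open>The upper estimate applied to \<open>\<phi>\<close> and to \<open>- \<phi>\<close>
  bounds the averages from both sides.\<close>

theorem birkhoff:
  assumes int: "integrable M \<phi>"
  shows "AE x in M. (\<lambda>n. birkhoff_sum T \<phi> n x / n) \<longlonglongrightarrow> (\<integral>x. \<phi> x \<partial>M)"
proof -
  have "integrable M (\<lambda>x. - \<phi> x)"
    using int by simp
  from birkhoff_limsup_le[OF int] birkhoff_limsup_le[OF this] show ?thesis
  proof eventually_elim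
    case (elim x)
    show ?case
    proof (rule order_tendstoI)
      fix a assume a: "a < (\<integral>x. \<phi> x \<partial>M)"
      from elim(2)[rule_format, of "(\<integral>x. \<phi> x \<partial>M) - a"] a
      show "\<forall>\<^sub>F n in sequentially. a < birkhoff_sum T \<phi> n x / n"
        by (simp add: birkhoff_sum_uminus)
    next
      fix a assume a: "(\<integral>x. \<phi> x \<partial>M) < a"
      from elim(1)[rule_format, of "a - (\<integral>x. \<phi> x \<partial>M)"] a
      show "\<forall>\<^sub>F n in sequentially. birkhoff_sum T \<phi> n x / n < a"
        by simp
    qed
  qed
qed

text \<open>The truncations \<open>min k L\<close> are integrable, and by monotone convergence their
  integrals are unbounded, since otherwise \<open>k\<close> would be integrable. Their averages lie
  below those of \<open>k\<close>.\<close>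

lemma birkhoff_at_top:
  fixes k :: "'a \<Rightarrow> real"
  assumes [measurable]: "k \<in> borel_measurable M" and nonneg: "\<And>x. 0 \<le> k x"
    and nint: "\<not> integrable M k"
  shows "AE x in M. filterlim (\<lambda>n. birkhoff_sum T k n x / n) at_top sequentially"
proof -
  define k' where "k' = (\<lambda>(L::nat) x. min (k x) L)"
  have k'_int: "integrable M (k' L)" for L
    unfolding k'_def by (rule integrable_const_bound[where B = L]) (auto simp: nonneg)
  have large: "\<exists>L. Z < (\<integral>x. k' L x \<partial>M)" for Z
  proof (rule ccontr)
    assume "\<nexists>L. Z < (\<integral>x. k' L x \<partial>M)"
    then have le: "(\<integral>x. k' L x \<partial>M) \<le> Z" for L
      by (simp add: not_less)
    have "incseq (\<lambda>L. \<integral>x. k' L x \<partial>M)"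
      by (intro monoI integral_mono k'_int) (auto simp: k'_def)
    with le obtain l where l: "(\<lambda>L. \<integral>x. k' L x \<partial>M) \<longlonglongrightarrow> l"
      using incseq_convergent by blast
    have lim: "(\<lambda>L. k' L x) \<longlonglongrightarrow> k x" for x
    proof -
      obtain N :: nat where "k x < N"
        using reals_Archimedean2 by blast
      then have "k' n x = k x" if "N \<le> n" for n
        using that by (simp add: k'_def)
      then show ?thesis
        by (intro tendsto_eventually eventually_sequentiallyI)
    qed
    have "integrable M k"
    proof (rule integrable_monotone_convergence[OF k'_int _ _ l])
      show "AE x in M. mono (\<lambda>L. k' L x)"
        by (auto simp: k'_def mono_def)
    qed (use lim in auto)
    with nint show False ..
  qed
  have "AE x in M. \<forall>L. (\<lambda>n. birkhoff_sum T (k' L) n x / n) \<longlonglongrightarrow> (\<integral>x. k' L x \<partial>M)"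
    unfolding AE_all_countable by (intro allI birkhoff k'_int)
  then show ?thesis
  proof eventually_elim
    case (elim x)
    show ?case
      unfolding filterlim_at_top_dense
    proof
      fix Z
      obtain L where "Z < (\<integral>x. k' L x \<partial>M)"
        using large by blast
      then have "\<forall>\<^sub>F n in sequentially. Z < birkhoff_sum T (k' L) n x / n"
        using elim order_tendstoD(1) by blast
      then show "\<forall>\<^sub>F n in sequentially. Z < birkhoff_sum T k n x / n"
      proof eventually_elim
        case (elim n)
        have "birkhoff_sum T (k' L) n x \<le> birkhoff_sum T k n x"
          unfolding birkhoff_sum_def by (intro sum_mono) (simp add: k'_def)
        then have "birkhoff_sum T (k' L) n x / n \<le> birkhoff_sum T k n x / n"
          by (rule divide_right_mono) simp
        with elim show ?case by simp
      qed
    qed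
  qed
qed

section \<open>Frequencies and times of visits to a set\<close>

lemma visit_frequency:
  assumes "A \<in> sets M"
  shows "AE x in M. (\<lambda>n. birkhoff_sum T (indicator A) n x / n) \<longlonglongrightarrow> prob A"
  using birkhoff[of "indicator A"] assms by (simp add: less_top[symmetric])

text \<open>More than \<open>a * q n\<close> of the first \<open>q n\<close> times are visits, while
  fewer than that many times lie before \<open>p n\<close>. So some visit falls between
  \<open>p n\<close> and \<open>q n\<close>.\<close>

lemma eventually_visit:
  assumes A: "A \<in> sets M" and a: "a < prob A"
    and q: "filterlim q at_top sequentially"
    and p: "\<forall>\<^sub>F n in sequentially. real (p n) < a * real (q n)"
  shows "AE x in M. \<forall>\<^sub>F n in sequentially. \<exists>t. p n \<le> t \<and> t < q n \<and> (T ^^ t) x \<in> A"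
  using visit_frequency[OF A]
proof eventually_elim
  case (elim x)
  let ?c = "\<lambda>n. birkhoff_sum T (indicator A) n x"
  have "\<forall>\<^sub>F n in sequentially. a < ?c n / n"
    using elim a by (rule order_tendstoD)
  from filterlim_iff[THEN iffD1, OF q, rule_format, OF this] p
  show ?case
    using filterlim_iff[THEN iffD1, OF q, rule_format, OF eventually_gt_at_top[of 0]]
  proof eventually_elim
    case (elim n)
    show ?case
    proof (rule ccontr)
      assume none: "\<nexists>t. p n \<le> t \<and> t < q n \<and> (T ^^ t) x \<in> A"
      have "?c (q n) = (\<Sum>i<q n. indicator A ((T ^^ i) x))"
        by (simp add: birkhoff_sum_def)
      also have "\<dots> \<le> (\<Sum>i<q n. indicator {..<p n} i)"
        using none by (intro sum_mono) (auto simp: indicator_def not_le)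
      also have "\<dots> = real (card ({..<q n} \<inter> {..<p n}))"
        by (simp add: sum.If_cases indicator_def lessThan_def)
      also have "\<dots> \<le> real (p n)"
        using card_mono[of "{..<p n}" "{..<q n} \<inter> {..<p n}"] by simp
      finally show False
        using elim by (simp add: field_simps)
    qed
  qed
qed

lemma AE_visit:
  assumes A: "A \<in> sets M" and pos: "0 < prob A"
  shows "AE x in M. \<exists>t. (T ^^ t) x \<in> A"
proof -
  have "\<forall>\<^sub>F n in sequentially. real 0 < prob A / 2 * real n"
    using eventually_gt_at_top[of 0] by eventually_elim (use pos in simp)
  then have "AE x in M. \<forall>\<^sub>F n in sequentially. \<exists>t\<ge>0. t < n \<and> (T ^^ t) x \<in> A"
    using pos by (intro eventually_visit[OF A, where a = "prob A / 2"] filterlim_ident) auto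
  then show ?thesis
    by eventually_elim (auto dest: eventually_happens)
qed

text \<open>Pigeonhole over \<open>t < p\<close>: visits to \<open>A\<close> at time
  \<open>t\<close> have density near \<open>prob A\<close>, visits to \<open>B\<close> at time
  \<open>t + p\<close> density near \<open>prob B\<close>. Densities adding up to more than 1 force
  a common \<open>t\<close>.\<close>

lemma eventually_paired_visits:
  assumes A: "A \<in> sets M" and B: "B \<in> sets M" and AB: "1 < prob A + prob B"
  shows "AE x in M. \<forall>\<^sub>F p in sequentially. \<exists>t<p. (T ^^ t) x \<in> A \<and> (T ^^ (t + p)) x \<in> B"
  using visit_frequency[OF A] visit_frequency[OF B]
proof eventually_elim
  case (elim x)
  let ?a = "\<lambda>n. birkhoff_sum T (indicator A) n x" and ?b = "\<lambda>n. birkhoff_sum T (indicator B) n x"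
  have "filterlim (\<lambda>n::nat. 2 * n) at_top sequentially"
    by (rule mult_nat_left_at_top) simp
  from filterlim_compose[OF elim(2) this]
  \<comment> \<open>The second summand is the number of visits to \<open>B\<close> at times from
    \<open>n\<close> to \<open>2 * n - 1\<close>, divided by \<open>n\<close>.\<close>
  have "(\<lambda>n. ?a n / n + (2 * (?b (2 * n) / real (2 * n)) - ?b n / n)) \<longlonglongrightarrow> prob A + (2 * prob B - prob B)"
    by (intro tendsto_intros elim)
  then have "\<forall>\<^sub>F n in sequentially. 1 < ?a n / n + (2 * (?b (2 * n) / real (2 * n)) - ?b n / n)"
    by (rule order_tendstoD) (use AB in simp)
  then show ?case
    using eventually_gt_at_top[of 0]
  proof eventually_elim
    case (elim p)
    then have *: "p < ?a p + (?b (2 * p) - ?b p)"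
      by (simp add: field_simps)
    have "?b (2 * p) = ?b p + (\<Sum>t<p. indicator B ((T ^^ (t + p)) x))"
      unfolding birkhoff_sum_def mult_2 lessThan_atLeast0
      by (subst sum.atLeastLessThan_concat[of 0 p "p + p", symmetric])
        (simp_all add: sum.shift_bounds_nat_ivl[of _ 0 p p, simplified])
    with * have "p < (\<Sum>t<p. indicator A ((T ^^ t) x) + indicator B ((T ^^ (t + p)) x) :: real)"
      by (simp add: birkhoff_sum_def sum.distrib)
    moreover have "(\<Sum>t<p. indicator A ((T ^^ t) x) + indicator B ((T ^^ (t + p)) x) :: real) \<le> (\<Sum>t<p. 1)"
      if "\<nexists>t. t < p \<and> (T ^^ t) x \<in> A \<and> (T ^^ (t + p)) x \<in> B"
      using that by (intro sum_mono) (auto simp: indicator_def)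
    ultimately show ?case
      by force
  qed
qed

end

section \<open>Symmetric sums over two-sided orbits\<close>

text \<open>The inverse is an argument of its own, so that reversing time amounts to swapping
  \<open>T\<close> and \<open>U\<close>.\<close>

definition orbit :: "('a \<Rightarrow> 'a) \<Rightarrow> ('a \<Rightarrow> 'a) \<Rightarrow> int \<Rightarrow> 'a \<Rightarrow> 'a" where
  "orbit T U i = (if 0 \<le> i then T ^^ nat i else U ^^ nat (- i))"

lemma orbit_int [simp]: "orbit T U (int n) = T ^^ n"
  by (simp add: orbit_def)

lemma orbit_minus: "orbit T U (- i) = orbit U T i"
  by (auto simp: orbit_def)

lemma birkhoff_sum_eq_orbit_sum: "birkhoff_sum T g n x = (\<Sum>i\<in>{0..<int n}. g (orbit T U i x))"
  unfolding birkhoff_sum_def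
  by (rule sum.reindex_bij_witness[of _ nat int]) auto

text \<open>Time 0 occurs in both one-sided sums, hence the correction by \<open>g x\<close>. The
  right-hand side is symmetric in \<open>T\<close> and \<open>U\<close>.\<close>

lemma symmetric_sum_eq:
  "(\<Sum>i\<in>{- int n..int n}. g (orbit T U i x)) =
     birkhoff_sum T g (Suc n) x + birkhoff_sum U g (Suc n) x - g x"
proof (induction n)
  case 0
  then show ?case by (simp add: birkhoff_sum_def orbit_def)
next
  case (Suc n)
  have "{- int (Suc n)..int (Suc n)} = insert (int (Suc n)) (insert (- int (Suc n)) {- int n..int n})"
    by auto
  then have "(\<Sum>i\<in>{- int (Suc n)..int (Suc n)}. g (orbit T U i x)) =
      g (orbit T U (int (Suc n)) x) + (g (orbit T U (- int (Suc n)) x) + (\<Sum>i\<in>{- int n..int n}. g (orbit T U i x)))"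
    by simp
  with Suc.IH show ?case
    by (simp only: orbit_minus orbit_int birkhoff_sum_Suc)
qed

text \<open>Two adjacent symmetric blocks centred at \<open>t\<^sub>1\<close> and \<open>t\<^sub>2\<close>: reflecting the left endpoint twice
  translates it by \<open>2 (t\<^sub>2 - t\<^sub>1)\<close>.\<close>

lemma sum_two_symmetric_blocks_nonpos:
  fixes u :: "int \<Rightarrow> real"
  assumes t1: "\<And>r. sum u {t1 - int r..t1 + int r} \<le> 0"
    and t2: "\<And>r. sum u {t2 - int r..t2 + int r} \<le> 0"
    and h: "h \<le> t1" "2 * t1 + 1 - h \<le> t2"
  shows "sum u {h..<h + 2 * (t2 - t1)} \<le> 0"
proof -
  let ?m = "2 * t1 + 1 - h"
  have "sum u {h..<h + 2 * (t2 - t1)} = sum u {h..<?m} + sum u {?m..<h + 2 * (t2 - t1)}"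
    using h by (subst sum.union_disjoint[symmetric]) (auto intro: arg_cong[where f = "sum u"])
  moreover have "{h..<?m} = {t1 - int (nat (t1 - h))..t1 + int (nat (t1 - h))}"
    using h by auto
  moreover have "{?m..<h + 2 * (t2 - t1)} = {t2 - int (nat (t2 - ?m))..t2 + int (nat (t2 - ?m))}"
    using h by auto
  ultimately show ?thesis
    using t1[of "nat (t1 - h)"] t2[of "nat (t2 - ?m)"] by simp
qed

section \<open>Invertible ergodic maps and time reversal\<close>

locale ergodic_automorphism = ergodic_map M T for M :: "'a measure" and T +
  fixes U :: "'a \<Rightarrow> 'a"
  assumes U_measurable [measurable]: "U \<in> measurable M M"
    and UT: "x \<in> space M \<Longrightarrow> U (T x) = x"
    and TU: "x \<in> space M \<Longrightarrow> T (U x) = x"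
begin

lemma inverse_ergodic_map: "ergodic_map M U"
proof unfold_locales
  show "emeasure M (U -` A \<inter> space M) = emeasure M A" if A: "A \<in> sets M" for A
  proof -
    have "T -` (U -` A \<inter> space M) \<inter> space M = A"
      using sets.sets_into_space[OF A] by (auto simp: UT T_space)
    moreover have "U -` A \<inter> space M \<in> sets M"
      using A by measurable
    ultimately show ?thesis
      using T_preserving by metis
  qed
  show "ergodic M U"
    unfolding ergodic_def
  proof (intro ballI impI)
    fix A assume A: "A \<in> sets M" "U -` A \<inter> space M = A"
    have "T x \<in> A \<longleftrightarrow> x \<in> A" if "x \<in> space M" for x
      using A(2) T_space[OF that] UT[OF that] by (metis IntE IntI vimage_eq)
    then have "T -` A \<inter> space M = A"
      using sets.sets_into_space[OF A(1)] by auto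
    then show "measure M A = 0 \<or> measure M A = 1"
      by (rule T_ergodic[unfolded ergodic_def, rule_format, OF A(1)])
  qed
qed (rule U_measurable)

sublocale bwd: ergodic_map M U
  by (rule inverse_ergodic_map)

text \<open>Lets every result on forward sums be reused for backward sums.\<close>

lemma inverse: "ergodic_automorphism M U T"
  by unfold_locales (auto simp: UT TU)

lemma U_funpow_T_funpow:
  "x \<in> space M \<Longrightarrow> j \<le> n \<Longrightarrow> (U ^^ j) ((T ^^ n) x) = (T ^^ (n - j)) x"
proof (induction j)
  case (Suc j)
  then have "n - j = Suc (n - Suc j)"
    by simp
  then have "(T ^^ (n - j)) x = T ((T ^^ (n - Suc j)) x)"
    by (metis funpow.simps(2) comp_apply)
  with Suc show ?case
    by (simp add: UT funpow_space)
qed simp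

lemma orbit_shift: "x \<in> space M \<Longrightarrow> orbit T U i (T x) = orbit T U (i + 1) x"
proof (cases "0 \<le> i")
  case True
  then show ?thesis
    by (simp add: orbit_def nat_add_distrib funpow_swap1)
next
  case False
  assume x: "x \<in> space M"
  from False obtain n where n: "i = - int (Suc n)"
    by (metis not_le int_cases nonneg_int_cases of_nat_0_le_iff)
  have "orbit T U i (T x) = (U ^^ n) x"
    unfolding n orbit_minus orbit_int using x by (simp add: funpow_swap1 UT)
  also have "\<dots> = orbit T U (i + 1) x"
    using orbit_minus[of T U "int n"] by (simp add: n)
  finally show ?thesis .
qed

lemma orbit_funpow: "x \<in> space M \<Longrightarrow> orbit T U i ((T ^^ n) x) = orbit T U (i + int n) x"
proof (induction n arbitrary: i)
  case (Suc n)
  then show ?case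
    by (simp add: orbit_shift funpow_space add_ac)
qed simp

text \<open>For every large \<open>n\<close> two blocks centred at visits to \<open>E\<close> tile
  an interval that ends just before time \<open>n\<close> and starts at some \<open>h\<close> in a
  window \<open>- 2 * R \<le> h \<le> 0\<close> independent of \<open>n\<close>. The sum over the
  interval is nonpositive, so the forward sum is at most the sum of absolute values over the
  window.\<close>

lemma birkhoff_sum_bdd_above_of_symmetric_sums:
  assumes E: "E \<in> sets M" "0 < prob E"
    and nonpos: "\<And>x r. x \<in> E \<Longrightarrow> (\<Sum>i\<in>{- int r..int r}. g (orbit T U i x)) \<le> 0"
  shows "AE x in M. bdd_above (range (\<lambda>n. birkhoff_sum T g n x))"
proof -
  note [measurable] = E(1)
  \<comment> \<open>Points that reach \<open>E\<close> in fewer than \<open>R\<close> steps. By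
    recurrence these sets exhaust the space up to a null set.\<close>
  define D where "D R = {x \<in> space M. \<exists>j<R. (T ^^ j) x \<in> E}" for R :: nat
  have D [measurable]: "D R \<in> sets M" for R
    unfolding D_def by measurable
  have "(\<lambda>R. prob (D R)) \<longlonglongrightarrow> prob (\<Union>R. D R)"
    by (rule finite_Lim_measure_incseq) (auto simp: incseq_def D_def intro: less_le_trans)
  moreover have "prob (\<Union>R. D R) = 1"
    using AE_visit[OF E] by (subst prob_eq_1) (auto simp: D_def)
  ultimately have "\<forall>\<^sub>F R in sequentially. 1 - prob E < prob (D R)"
    using E(2) by (intro order_tendstoD) auto
  then obtain R where R: "1 - prob E < prob (D R)"
    by (auto dest: eventually_happens)
  \<comment> \<open>The delay by \<open>R\<close> separates the two centres far enough: the tiling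
    needs \<open>t + j + 2 \<le> p + R\<close>, which follows from \<open>t < p\<close> and
    \<open>j < R\<close>.\<close>
  define B where "B = (T ^^ R) -` D R \<inter> space M"
  have B: "B \<in> sets M"
    unfolding B_def by measurable
  have "1 < prob E + prob B"
    using R prob_funpow[OF D, of R R] by (simp add: B_def)
  from eventually_paired_visits[OF E(1) B this] AE_space show ?thesis
  proof eventually_elim
    case (elim x)
    then obtain P where P: "\<exists>t<p. (T ^^ t) x \<in> E \<and> (T ^^ (t + p)) x \<in> B" if "P \<le> p" for p
      by (auto simp: eventually_sequentially)
    define u where "u i = g (orbit T U i x)" for i
    have block: "sum u {int t - int r..int t + int r} \<le> 0" if "(T ^^ t) x \<in> E" for t r
    proof -
      have "sum u {int t - int r..int t + int r} = (\<Sum>i\<in>{- int r..int r}. g (orbit T U i ((T ^^ t) x)))"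
        unfolding u_def orbit_funpow[OF elim(2)]
        by (rule sum.reindex_bij_witness[of _ "\<lambda>i. i + int t" "\<lambda>i. i - int t"]) auto
      with nonpos[OF that] show ?thesis
        by simp
    qed
    let ?C = "\<Sum>i\<in>{- 2 * int R..<0}. \<bar>u i\<bar>"
    have bound: "birkhoff_sum T g n x \<le> ?C" if n: "2 * (P + R) \<le> n" for n
    proof -
      \<comment> \<open>Makes \<open>2 * (p + R)\<close> equal to \<open>n\<close> or
        \<open>n + 1\<close>. The centres \<open>t\<close> and \<open>t + p + R + j\<close> then
        give a tiled interval ending at \<open>n\<close> whose start \<open>h\<close> is
        \<open>- 2 * j\<close> or \<open>- 2 * j - 1\<close>.\<close>
      define p where "p = (n + 1) div 2 - R"
      have pR: "p + R = (n + 1) div 2" and "P \<le> p"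
        using n by (auto simp: p_def)
      from P[OF this(2)] obtain t where t: "t < p" "(T ^^ t) x \<in> E" "(T ^^ (t + p)) x \<in> B"
        by blast
      then obtain j where j: "j < R" "(T ^^ j) ((T ^^ R) ((T ^^ (t + p)) x)) \<in> E"
        by (auto simp: B_def D_def)
      then have j': "(T ^^ (j + R + (t + p))) x \<in> E"
        by (simp add: funpow_add)
      define h where "h = int n - 2 * int (p + R + j)"
      have pR': "n \<le> 2 * (p + R)" "2 * (p + R) \<le> n + 1"
        unfolding pR by presburger+
      have h: "- 2 * int R \<le> h" "h \<le> 0" "- h \<le> 1 + 2 * int j"
        using pR' j(1) by (auto simp: h_def)
      have "sum u {h..<h + 2 * (int (j + R + (t + p)) - int t)} \<le> 0"
        by (rule sum_two_symmetric_blocks_nonpos block t j')+ (use h t(1) j(1) in auto)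
      also have "h + 2 * (int (j + R + (t + p)) - int t) = int n"
        by (simp add: h_def)
      finally have "sum u {h..<0} + sum u {0..<int n} \<le> 0"
        using h by (subst sum.union_disjoint[symmetric]) (auto simp: ivl_disj_un_two)
      moreover have "- sum u {h..<0} \<le> (\<Sum>i\<in>{h..<0}. \<bar>u i\<bar>)"
        unfolding sum_negf[symmetric] by (rule sum_mono) simp
      moreover have "\<dots> \<le> ?C"
        using h by (intro sum_mono2) auto
      ultimately show ?thesis
        by (simp add: birkhoff_sum_eq_orbit_sum[of T g n x U] u_def)
    qed
    have "range (\<lambda>n. birkhoff_sum T g n x) \<subseteq> (\<lambda>n. birkhoff_sum T g n x) ` {..<2 * (P + R)} \<union> {..?C}"
    proof (rule image_subsetI)
      show "birkhoff_sum T g n x \<in> (\<lambda>n. birkhoff_sum T g n x) ` {..<2 * (P + R)} \<union> {..?C}" for n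
        using bound[of n] by (cases "n < 2 * (P + R)") simp_all
    qed
    then show ?case
      by (rule bdd_above_mono[rotated]) (auto intro: bdd_above_finite)
  qed
qed

text \<open>A point with controlled backward growth is visited at times within a factor close to \<open>1\<close> of \<open>n\<close>,
  and the growth bound at that visit controls \<open>h\<close> at time \<open>n\<close>.\<close>

lemma sublinear_of_linear_growth:
  assumes [measurable]: "h \<in> borel_measurable M" and nonneg: "\<And>x. 0 \<le> h x" and C: "0 \<le> C"
    and growth: "AE x in M. \<exists>N::nat. \<forall>j. h ((U ^^ j) x) \<le> C * real j + real N"
  shows "AE x in M. (\<lambda>n. h ((T ^^ n) x) / n) \<longlonglongrightarrow> 0 \<and> (\<lambda>n. h ((U ^^ n) x) / n) \<longlonglongrightarrow> 0"
proof -
  define G where "G N = {x \<in> space M. \<forall>j. h ((U ^^ j) x) \<le> C * real j + real N}" for N :: nat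
  have G [measurable]: "G N \<in> sets M" for N
    unfolding G_def by measurable
  have "incseq G"
  proof (rule incseq_SucI, rule subsetI)
    fix N x assume x: "x \<in> G N"
    have "h ((U ^^ j) x) \<le> C * real j + real (Suc N)" for j
    proof -
      have "h ((U ^^ j) x) \<le> C * real j + real N"
        using x by (simp add: G_def)
      then show ?thesis
        by simp
    qed
    then show "x \<in> G (Suc N)"
      using x by (simp add: G_def)
  qed
  then have "(\<lambda>N. prob (G N)) \<longlonglongrightarrow> prob (\<Union>N. G N)"
    by (intro finite_Lim_measure_incseq) auto
  moreover have "prob (\<Union>N. G N) = 1"
    using growth by (subst prob_eq_1) (auto simp: G_def)
  ultimately have G_lim: "(\<lambda>N. prob (G N)) \<longlonglongrightarrow> 1"
    by simp
  have step: "AE x in M. \<forall>\<^sub>F n in sequentially.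
      h ((T ^^ n) x) / n \<le> (C + 1) * e \<and> h ((U ^^ n) x) / n \<le> (C + 1) * e"
    if e: "0 < e" "e < 1" for e
  proof -
    \<comment> \<open>The first threshold yields forward visits between \<open>n\<close> and
      \<open>(1 + e) * n\<close>, the second backward visits between about
      \<open>(1 - e) * n\<close> and \<open>n\<close>.\<close>
    have "\<forall>\<^sub>F N in sequentially. max (1 / (1 + e)) (1 - e / 2) < prob (G N)"
      using e by (intro order_tendstoD[OF G_lim]) auto
    then obtain N where N: "1 / (1 + e) < prob (G N)" "1 - e / 2 < prob (G N)"
      by (auto dest: eventually_happens)
    have large: "\<forall>\<^sub>F n in sequentially. (C + real N) / e < real n"
      using filterlim_real_sequentially unfolding filterlim_at_top_dense by blast
    have "AE x in M. \<forall>\<^sub>F n in sequentially. \<exists>t\<ge>n. t < nat \<lfloor>(1 + e) * n\<rfloor> + 1 \<and> (T ^^ t) x \<in> G N"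
    proof (rule eventually_visit[OF G N(1)])
      have le: "real n < 1 / (1 + e) * real (nat \<lfloor>(1 + e) * n\<rfloor> + 1)" for n :: nat
      proof -
        have "0 \<le> (1 + e) * n"
          using e by simp
        then have "(1 + e) * n < real (nat \<lfloor>(1 + e) * n\<rfloor> + 1)"
          by linarith
        then show ?thesis
          using e by (simp add: field_simps)
      qed
      show "filterlim (\<lambda>n. nat \<lfloor>(1 + e) * real n\<rfloor> + 1) at_top sequentially"
      proof (rule filterlim_at_top_mono[OF filterlim_ident always_eventually], rule allI)
        show "n \<le> nat \<lfloor>(1 + e) * real n\<rfloor> + 1" for n
        proof -
          have "real n \<le> (1 + e) * n"
            using e by (simp add: algebra_simps)
          then show ?thesis by linarith
        qed
      qed
      show "\<forall>\<^sub>F n in sequentially. real n < 1 / (1 + e) * real (nat \<lfloor>(1 + e) * n\<rfloor> + 1)"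
        using le by simp
    qed
    moreover have "AE x in M. \<forall>\<^sub>F n in sequentially. \<exists>t\<ge>nat \<lfloor>(1 - e) * n\<rfloor>. t < n \<and> (U ^^ t) x \<in> G N"
    proof (rule bwd.eventually_visit[OF G N(2) filterlim_ident])
      show "\<forall>\<^sub>F n in sequentially. real (nat \<lfloor>(1 - e) * n\<rfloor>) < (1 - e / 2) * real n"
        using eventually_gt_at_top[of 0]
      proof eventually_elim
        case (elim n)
        have "0 \<le> (1 - e) * n" "(1 - e) * n < (1 - e / 2) * n"
          using e elim by auto
        then show ?case by linarith
      qed
    qed
    ultimately show ?thesis
      using AE_space
    proof eventually_elim
      case (elim x)
      show ?case
        using elim(1,2) large eventually_gt_at_top[of 0]
      proof eventually_elim
        case (elim n)
        have n: "C + real N \<le> e * n"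
          using elim e by (simp add: field_simps)
        from elim(1) obtain t where t: "n \<le> t" "t < nat \<lfloor>(1 + e) * n\<rfloor> + 1" "(T ^^ t) x \<in> G N"
          by blast
        have "0 \<le> (1 + e) * n"
          using e by simp
        then have "real t \<le> (1 + e) * n"
          using t(2) by linarith
        then have tn: "real (t - n) \<le> e * n"
          using t(1) by (simp add: of_nat_diff algebra_simps)
        \<comment> \<open>The growth bound only looks backward, so time \<open>n\<close> is reached
          from a later visit at \<open>t\<close>. For negative times the visit at \<open>- s\<close>
          with \<open>s < n\<close> plays this part.\<close>
        have "(T ^^ n) x = (U ^^ (t - n)) ((T ^^ t) x)"
          using U_funpow_T_funpow[of x "t - n" t] t(1) \<open>x \<in> space M\<close> by simp
        then have "h ((T ^^ n) x) \<le> C * real (t - n) + real N"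
          using t(3) by (simp add: G_def)
        also have "\<dots> \<le> C * (e * n) + real N"
          using tn C by (intro add_mono mult_left_mono) auto
        finally have 1: "h ((T ^^ n) x) \<le> (C + 1) * e * n"
          using n C by (simp add: algebra_simps)
        from elim(2) obtain s where s: "nat \<lfloor>(1 - e) * n\<rfloor> \<le> s" "s < n" "(U ^^ s) x \<in> G N"
          by blast
        have "(1 - e) * n - 1 \<le> real s"
          using s(1) by linarith
        then have sn: "real (n - s) \<le> e * n + 1"
          using s(2) by (simp add: of_nat_diff algebra_simps)
        have "(U ^^ n) x = (U ^^ (n - s)) ((U ^^ s) x)"
          using s(2) funpow_add[of "n - s" s U] by simp
        then have "h ((U ^^ n) x) \<le> C * real (n - s) + real N"
          using s(3) by (simp add: G_def)
        also have "\<dots> \<le> C * (e * n + 1) + real N"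
          using sn C by (intro add_mono mult_left_mono) auto
        finally have 2: "h ((U ^^ n) x) \<le> (C + 1) * e * n"
          using n by (simp add: algebra_simps)
        show ?case
          using 1 2 elim(4) by (simp add: field_simps)
      qed
    qed
  qed
  have "AE x in M. \<forall>k::nat. \<forall>\<^sub>F n in sequentially.
      h ((T ^^ n) x) / n \<le> (C + 1) * (1 / real (k + 2)) \<and> h ((U ^^ n) x) / n \<le> (C + 1) * (1 / real (k + 2))"
    unfolding AE_all_countable by (intro allI step) auto
  then show ?thesis
  proof eventually_elim
    case (elim x)
    have small: "\<forall>\<^sub>F n in sequentially. h ((T ^^ n) x) / n < a \<and> h ((U ^^ n) x) / n < a" if "0 < a" for a
    proof -
      obtain k :: nat where "(C + 1) / a < k"
        using reals_Archimedean2 by blast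
      then have "(C + 1) * (1 / real (k + 2)) < a"
        using \<open>0 < a\<close> by (simp add: field_simps)
      then show ?thesis
        by (intro eventually_mono[OF elim[rule_format, of k]]) auto
    qed
    have pos: "a < h y / real n" if "a < 0" for a y n
      using that nonneg[of y] by (meson divide_nonneg_nonneg less_le_trans of_nat_0_le_iff)
    have "(\<lambda>n. h ((T ^^ n) x) / n) \<longlonglongrightarrow> 0"
      by (rule order_tendstoI) (use pos in simp, use small in \<open>auto simp: eventually_conj_iff\<close>)
    moreover have "(\<lambda>n. h ((U ^^ n) x) / n) \<longlonglongrightarrow> 0"
      by (rule order_tendstoI) (use pos in simp, use small in \<open>auto simp: eventually_conj_iff\<close>)
    ultimately show ?case ..
  qed
qed

section \<open>Convergence of the averages\<close>

lemma averages_dichotomy: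
  assumes [measurable]: "g \<in> borel_measurable M"
    and fwd: "AE x in M. bdd_above (range (\<lambda>n. birkhoff_sum T g n x))"
    and bwd: "AE x in M. bdd_above (range (\<lambda>n. birkhoff_sum U g n x))"
  shows "(\<exists>c. AE x in M. (\<lambda>n. birkhoff_sum T g n x / n) \<longlonglongrightarrow> c \<and> (\<lambda>n. birkhoff_sum U g n x / n) \<longlonglongrightarrow> c) \<or>
         (AE x in M. filterlim (\<lambda>n. birkhoff_sum T g n x / n) at_bot sequentially)"
proof -
  let ?bdd = "\<lambda>x. bdd_above (range (\<lambda>n. birkhoff_sum T g n x))"
  \<comment> \<open>Nonnegative because \<open>n = 0\<close> contributes 0. Where the supremum is
    infinite the conversion yields 0, which by \<open>fwd\<close> concerns a null set only.\<close>
  define h where "h x = real_of_ereal (SUP n. ereal (birkhoff_sum T g n x))" for x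
  \<comment> \<open>The cut at 0 makes \<open>k\<close> nonnegative everywhere; it has no effect
    where the forward sums are bounded, since there \<open>g x + h (T x) \<le> h x\<close>.\<close>
  define k where "k x = max 0 (h x - h (T x) - g x)" for x
  have [measurable]: "h \<in> borel_measurable M"
    unfolding h_def by measurable
  have k_measurable [measurable]: "k \<in> borel_measurable M"
    unfolding k_def by measurable
  have h_nonneg: "0 \<le> h x" for x
    unfolding h_def by (intro real_of_ereal_pos SUP_upper2[of 0]) auto
  have k_nonneg: "0 \<le> k x" for x
    by (simp add: k_def)
  have sup: "ereal (h x) = (SUP n. ereal (birkhoff_sum T g n x))" if "?bdd x" for x
  proof -
    let ?S = "SUP n. ereal (birkhoff_sum T g n x)"
    obtain C where "birkhoff_sum T g n x \<le> C" for n
      using \<open>?bdd x\<close> by (auto simp: bdd_above_def)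
    then have "?S \<le> ereal C"
      by (intro SUP_least) simp
    moreover have "0 \<le> ?S"
      by (intro SUP_upper2[of 0]) auto
    ultimately have "\<bar>?S\<bar> \<noteq> \<infinity>"
      by auto
    then show ?thesis
      by (simp add: h_def ereal_real')
  qed
  have h_upper: "birkhoff_sum T g n x \<le> h x" if "?bdd x" for n x
    using sup[OF that] SUP_upper[of n UNIV "\<lambda>n. ereal (birkhoff_sum T g n x)"] by (metis UNIV_I ereal_less_eq(3))
  have h_least: "h x \<le> C" if "?bdd x" "\<And>n. birkhoff_sum T g n x \<le> C" for x C
  proof -
    have "(SUP n. ereal (birkhoff_sum T g n x)) \<le> ereal C"
      by (intro SUP_least) (simp add: that(2))
    then show ?thesis
      by (simp add: sup[OF that(1), symmetric])
  qed
  have k: "k x = h x - h (T x) - g x" if x: "?bdd x" for x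
  proof -
    have "birkhoff_sum T g n (T x) \<le> h x - g x" for n
      using h_upper[OF x, of "Suc n"] by (simp add: birkhoff_sum_Suc_shift)
    then have "h (T x) \<le> h x - g x"
      using x by (intro h_least) (simp_all add: bdd_above_birkhoff_sum_shift)
    then show ?thesis
      by (simp add: k_def)
  qed
  have fwd_bdd: "?bdd ((T ^^ n) x)" if "?bdd x" for n x
    using that by (induction n) (simp_all add: bdd_above_birkhoff_sum_shift)
  have bwd_bdd: "?bdd ((U ^^ n) x)" if "?bdd x" "x \<in> space M" for n x
  proof (induction n)
    case (Suc n)
    then show ?case
      using bdd_above_birkhoff_sum_shift[of T g "(U ^^ Suc n) x"] TU[OF bwd.funpow_space, OF that(2)] by simp
  qed (use that in simp)
  have fwd_sum: "birkhoff_sum T g n x = h x - h ((T ^^ n) x) - birkhoff_sum T k n x" if "?bdd x" for n x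
    by (induction n) (simp_all add: birkhoff_sum_Suc k[OF fwd_bdd[OF that]])
  \<comment> \<open>The backward sum starts with the term at time 0, which involves
    \<open>h (T x)\<close>; this shifts the indices by one.\<close>
  have bwd_sum: "birkhoff_sum U g (Suc n) x = h ((U ^^ n) x) - h (T x) - birkhoff_sum U k (Suc n) x"
    if x: "?bdd x" "x \<in> space M" for n x
  proof (induction n)
    case 0
    then show ?case
      by (simp add: birkhoff_sum_Suc k[OF x(1)])
  next
    case (Suc n)
    have "k ((U ^^ Suc n) x) = h ((U ^^ Suc n) x) - h ((U ^^ n) x) - g ((U ^^ Suc n) x)"
      using k[OF bwd_bdd[OF x, of "Suc n"]] TU[OF bwd.funpow_space, OF x(2)] by simp
    with Suc.IH show ?case
      unfolding birkhoff_sum_Suc[of U _ "Suc n"] by linarith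
  qed
  show ?thesis
  proof (cases "integrable M k")
    case True
    define \<kappa> where "\<kappa> = (\<integral>x. k x \<partial>M)"
    have "0 \<le> \<kappa>"
      unfolding \<kappa>_def by (intro integral_nonneg_AE) (simp add: k_nonneg)
    have "AE x in M. bdd_above (range (\<lambda>n. birkhoff_sum U k n x - real n * (\<kappa> + 1)))"
      unfolding \<kappa>_def by (rule bwd.birkhoff_sum_diff_bdd_above[OF True]) simp
    from this fwd bwd AE_space
    have "AE x in M. \<exists>N::nat. \<forall>j. h ((U ^^ j) x) \<le> (\<kappa> + 1) * real j + real N"
    proof eventually_elim
      case (elim x)
      obtain C where C: "birkhoff_sum U k n x - real n * (\<kappa> + 1) \<le> C" for n
        using elim(1) by (auto simp: bdd_above_def)
      obtain C' where C': "birkhoff_sum U g n x \<le> C'" for n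
        using elim(3) by (auto simp: bdd_above_def)
      obtain N :: nat where N: "C + C' + h (T x) + \<kappa> + 1 < real N"
        using reals_Archimedean2 by blast
      \<comment> \<open>\<open>bwd_sum\<close> is solved for \<open>h ((U ^^ j) x)\<close>: the
        backward sums of \<open>g\<close> are bounded and those of \<open>k\<close> grow at rate at
        most \<open>\<kappa> + 1\<close>.\<close>
      have "h ((U ^^ j) x) \<le> (\<kappa> + 1) * real j + real N" for j
        using C[of "Suc j"] C'[of "Suc j"] N bwd_sum[OF elim(2,4), of j] by (simp add: algebra_simps)
      then show ?case by blast
    qed
    then have "AE x in M. (\<lambda>n. h ((T ^^ n) x) / n) \<longlonglongrightarrow> 0 \<and> (\<lambda>n. h ((U ^^ n) x) / n) \<longlonglongrightarrow> 0"
      using \<open>0 \<le> \<kappa>\<close> h_nonneg by (intro sublinear_of_linear_growth[where C = "\<kappa> + 1"]) auto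
    from this birkhoff[OF True] bwd.birkhoff[OF True] fwd AE_space
    have "AE x in M. (\<lambda>n. birkhoff_sum T g n x / n) \<longlonglongrightarrow> - \<kappa> \<and> (\<lambda>n. birkhoff_sum U g n x / n) \<longlonglongrightarrow> - \<kappa>"
    proof eventually_elim
      case (elim x)
      have "(\<lambda>n. h x / real n - h ((T ^^ n) x) / n - birkhoff_sum T k n x / n) \<longlonglongrightarrow> 0 - 0 - \<kappa>"
        using elim(1,2) by (intro tendsto_diff lim_const_over_n) (auto simp: \<kappa>_def)
      then have 1: "(\<lambda>n. birkhoff_sum T g n x / n) \<longlonglongrightarrow> - \<kappa>"
        by (simp add: fwd_sum[OF elim(4)] diff_divide_distrib)
      \<comment> \<open>The factor \<open>n / Suc n\<close> reconciles the index \<open>n\<close> of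
        the end term with the denominator \<open>Suc n\<close>.\<close>
      have "(\<lambda>n. h ((U ^^ n) x) / n * (real n / real (Suc n)) - h (T x) / real (Suc n) -
          birkhoff_sum U k (Suc n) x / real (Suc n)) \<longlonglongrightarrow> 0 * 1 - 0 - \<kappa>"
        using elim(1,3) unfolding \<kappa>_def
        by (intro tendsto_diff tendsto_mult LIMSEQ_n_over_Suc_n LIMSEQ_Suc[OF lim_const_over_n]
            LIMSEQ_Suc[of "\<lambda>n. birkhoff_sum U k n x / real n"]) auto
      moreover have "\<forall>\<^sub>F n in sequentially. h ((U ^^ n) x) / n * (real n / real (Suc n)) - h (T x) / real (Suc n) -
          birkhoff_sum U k (Suc n) x / real (Suc n) = birkhoff_sum U g (Suc n) x / real (Suc n)"
        unfolding bwd_sum[OF elim(4,5)] using eventually_gt_at_top[of 0]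
        by eventually_elim (simp add: diff_divide_distrib)
      ultimately have "(\<lambda>n. birkhoff_sum U g (Suc n) x / real (Suc n)) \<longlonglongrightarrow> - \<kappa>"
        using Lim_transform_eventually by fastforce
      then have "(\<lambda>n. birkhoff_sum U g n x / n) \<longlonglongrightarrow> - \<kappa>"
        by (rule LIMSEQ_imp_Suc)
      with 1 show ?case ..
    qed
    then show ?thesis by blast
  next
    case False
    from birkhoff_at_top[OF k_measurable k_nonneg False] fwd
    have "AE x in M. filterlim (\<lambda>n. birkhoff_sum T g n x / n) at_bot sequentially"
    proof eventually_elim
      case (elim x)
      have "filterlim (\<lambda>n. - (h x / real n) + birkhoff_sum T k n x / n) at_top sequentially"
        by (rule filterlim_tendsto_add_at_top[OF tendsto_minus[OF lim_const_over_n] elim(1)])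
      then have "filterlim (\<lambda>n. - (birkhoff_sum T g n x / n)) at_top sequentially"
      proof (rule filterlim_at_top_mono[OF _ always_eventually], intro allI)
        fix n
        have "birkhoff_sum T g n x \<le> h x - birkhoff_sum T k n x"
          using fwd_sum[OF elim(2), of n] h_nonneg[of "(T ^^ n) x"] by simp
        then have "birkhoff_sum T g n x / n \<le> (h x - birkhoff_sum T k n x) / n"
          by (rule divide_right_mono) simp
        then show "- (h x / real n) + birkhoff_sum T k n x / n \<le> - (birkhoff_sum T g n x / n)"
          by (simp add: diff_divide_distrib)
      qed
      then show ?case
        by (simp add: filterlim_uminus_at_bot)
    qed
    then show ?thesis ..
  qed
qed

text \<open>The dichotomy is applied to \<open>T\<close> and to \<open>U\<close>. A finite limit in
  either application settles both directions; otherwise each application contributes divergence in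
  its own direction.\<close>

lemma averages_converge:
  assumes g: "g \<in> borel_measurable M"
    and fwd: "AE x in M. bdd_above (range (\<lambda>n. birkhoff_sum T g n x))"
    and bwd: "AE x in M. bdd_above (range (\<lambda>n. birkhoff_sum U g n x))"
  shows "\<exists>c::ereal. c \<noteq> \<infinity> \<and> (AE x in M. (\<lambda>n. ereal (birkhoff_sum T g n x / n)) \<longlonglongrightarrow> c \<and>
                                   (\<lambda>n. ereal (birkhoff_sum U g n x / n)) \<longlonglongrightarrow> c)"
proof -
  interpret inv: ergodic_automorphism M U T
    by (rule inverse)
  from averages_dichotomy[OF g fwd bwd] inv.averages_dichotomy[OF g bwd fwd]
  consider c where "AE x in M. (\<lambda>n. birkhoff_sum T g n x / n) \<longlonglongrightarrow> c \<and> (\<lambda>n. birkhoff_sum U g n x / n) \<longlonglongrightarrow> c"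
    | c where "AE x in M. (\<lambda>n. birkhoff_sum U g n x / n) \<longlonglongrightarrow> c \<and> (\<lambda>n. birkhoff_sum T g n x / n) \<longlonglongrightarrow> c"
    | "AE x in M. filterlim (\<lambda>n. birkhoff_sum T g n x / n) at_bot sequentially"
      "AE x in M. filterlim (\<lambda>n. birkhoff_sum U g n x / n) at_bot sequentially"
    by blast
  then show ?thesis
  proof cases
    case 1
    then show ?thesis by (intro exI[of _ "ereal c"]) (simp add: lim_ereal)
  next
    case 2
    then show ?thesis by (intro exI[of _ "ereal c"]) (simp add: lim_ereal conj_commute)
  next
    case 3
    then have "AE x in M. (\<lambda>n. ereal (birkhoff_sum T g n x / n)) \<longlonglongrightarrow> - \<infinity> \<and>
        (\<lambda>n. ereal (birkhoff_sum U g n x / n)) \<longlonglongrightarrow> - \<infinity>"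
      by eventually_elim (simp add: ereal_tendsto_simps2(3)[unfolded comp_def])
    then show ?thesis by (intro exI[of _ "- \<infinity>"]) simp
  qed
qed

end

section \<open>Bilateral averages and the given definitions\<close>

text \<open>Each one-sided average receives weight \<open>Suc n / (2 * n + 1)\<close>, which tends
  to 1/2, and the doubly counted term \<open>y\<close> vanishes in the limit.\<close>

lemma bilateral_limit:
  fixes a b :: "nat \<Rightarrow> real" and c :: ereal
  assumes a: "(\<lambda>n. ereal (a n / n)) \<longlonglongrightarrow> c" and b: "(\<lambda>n. ereal (b n / n)) \<longlonglongrightarrow> c" and c: "c \<noteq> \<infinity>"
  shows "(\<lambda>n. ereal ((a (Suc n) + b (Suc n) - y) / real (2 * n + 1))) \<longlonglongrightarrow> c"
proof (cases c)
  case (real r)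
  have "(\<lambda>n. a (Suc n) / real (Suc n)) \<longlonglongrightarrow> r" "(\<lambda>n. b (Suc n) / real (Suc n)) \<longlonglongrightarrow> r"
    using LIMSEQ_Suc[OF a] LIMSEQ_Suc[OF b] by (simp_all add: real lim_ereal)
  moreover have "(\<lambda>n. real (Suc n) / real (2 * n + 1)) \<longlonglongrightarrow> 1 / 2" "(\<lambda>n. y / real (2 * n + 1)) \<longlonglongrightarrow> 0"
    by real_asymp+
  ultimately have "(\<lambda>n. (a (Suc n) / real (Suc n) + b (Suc n) / real (Suc n)) * (real (Suc n) / real (2 * n + 1))
      - y / real (2 * n + 1)) \<longlonglongrightarrow> (r + r) * (1 / 2) - 0"
    by (intro tendsto_diff tendsto_mult tendsto_add)
  moreover have "(a (Suc n) / real (Suc n) + b (Suc n) / real (Suc n)) * (real (Suc n) / real (2 * n + 1))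
      - y / real (2 * n + 1) = (a (Suc n) + b (Suc n) - y) / real (2 * n + 1)" for n
    by (simp add: add_divide_distrib diff_divide_distrib distrib_right del: of_nat_Suc)
  ultimately show ?thesis
    by (simp add: real lim_ereal)
next
  case MInf
  have a': "filterlim (\<lambda>n. a (Suc n) / real (Suc n)) at_bot sequentially"
    and b': "filterlim (\<lambda>n. b (Suc n) / real (Suc n)) at_bot sequentially"
    using LIMSEQ_Suc[OF a] LIMSEQ_Suc[OF b] by (simp_all add: MInf ereal_tendsto_simps2(3)[unfolded comp_def])
  have "filterlim (\<lambda>n. (a (Suc n) + b (Suc n) - y) / real (2 * n + 1)) at_bot sequentially"
    unfolding filterlim_at_bot
  proof
    fix Z
    \<comment> \<open>As \<open>2 * Suc n = (2 * n + 1) + 1\<close>, bounding both averages by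
      \<open>- ?W\<close> leaves a surplus of \<open>?W\<close>, which absorbs
      \<open>y\<close>.\<close>
    let ?W = "\<bar>Z\<bar> + \<bar>y\<bar>"
    show "\<forall>\<^sub>F n in sequentially. (a (Suc n) + b (Suc n) - y) / real (2 * n + 1) \<le> Z"
      using a'[unfolded filterlim_at_bot, rule_format, of "- ?W"]
        b'[unfolded filterlim_at_bot, rule_format, of "- ?W"]
    proof eventually_elim
      case (elim n)
      then have "a (Suc n) \<le> - ?W * real (Suc n)" "b (Suc n) \<le> - ?W * real (Suc n)"
        by (simp_all add: pos_divide_le_eq del: of_nat_Suc)
      then have "a (Suc n) + b (Suc n) - y \<le> - ?W * real (2 * n + 1) + \<bar>y\<bar> - ?W"
        using abs_ge_minus_self[of y] by (simp add: algebra_simps)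
      also have "\<dots> = - \<bar>Z\<bar> * real (2 * n + 1) - (\<bar>Z\<bar> + \<bar>y\<bar> * real (2 * n + 1))"
        by (simp add: algebra_simps)
      also have "\<dots> \<le> - \<bar>Z\<bar> * real (2 * n + 1)"
        unfolding diff_le_eq le_add_same_cancel1 by (intro add_nonneg_nonneg mult_nonneg_nonneg) auto
      also have "\<dots> \<le> Z * real (2 * n + 1)"
        by (intro mult_right_mono) auto
      finally show ?case
        by (simp add: pos_divide_le_eq)
    qed
  qed
  then show ?thesis
    by (simp add: MInf ereal_tendsto_simps2(3)[unfolded comp_def])
qed (use c in simp)

lemma Tpow_eq_orbit: "Tpow M T i = orbit T (Tinv M T) i"
  by (simp add: Tpow_def orbit_def)

lemma fwd_avg_eq: "fwd_avg M T f n x = birkhoff_sum T f n x / n"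
  by (simp add: fwd_avg_def birkhoff_sum_def Tpow_eq_orbit)

lemma bwd_avg_eq: "bwd_avg M T f n x = birkhoff_sum (Tinv M T) f n x / n"
  by (simp add: bwd_avg_def birkhoff_sum_def Tpow_eq_orbit orbit_minus)

lemma bil_avg_eq:
  "bil_avg M T f n x =
     (birkhoff_sum T f (Suc n) x + birkhoff_sum (Tinv M T) f (Suc n) x - f x) / real (2 * n + 1)"
  by (simp only: bil_avg_def Tpow_eq_orbit symmetric_sum_eq)

lemma ergodic_automorphism_Tinv:
  assumes "prob_space M" and T: "invertible_mpt M T" and erg: "ergodic M T"
  shows "ergodic_automorphism M T (Tinv M T)"
proof -
  interpret prob_space M by fact
  have bij: "inj_on T (space M)" "T ` space M = space M"
    using T by (auto simp: invertible_mpt_def bij_betw_def)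
  show ?thesis
    using T erg the_inv_into_f_f[OF bij(1)] f_the_inv_into_f[OF bij(1)] bij(2)
    by unfold_locales (auto simp: invertible_mpt_def Tinv_def)
qed

theorem theorem1:
  fixes M :: "'a measure" and T :: "'a \<Rightarrow> 'a" and f :: "'a \<Rightarrow> real"
  assumes "prob_space M"
    and "invertible_mpt M T"
    and "ergodic M T"
    and "f \<in> borel_measurable M"
    and "\<exists>E\<in>sets M. measure M E > 0 \<and>
           (AE x in M. x \<in> E \<longrightarrow> limsup (\<lambda>n. ereal (bil_avg M T f n x)) < \<infinity>)"
  shows "\<exists>c::ereal. c \<noteq> \<infinity> \<and>
           (AE x in M. (\<lambda>n. ereal (fwd_avg M T f n x)) \<longlonglongrightarrow> c \<and>
                       (\<lambda>n. ereal (bwd_avg M T f n x)) \<longlonglongrightarrow> c \<and>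
                       (\<lambda>n. ereal (bil_avg M T f n x)) \<longlonglongrightarrow> c)"
proof -
  define U where "U = Tinv M T"
  interpret ergodic_automorphism M T U
    unfolding U_def using assms(1-3) by (rule ergodic_automorphism_Tinv)
  interpret inv: ergodic_automorphism M U T
    by (rule inverse)
  note [measurable] = assms(4)
  have [measurable]: "bil_avg M T f n \<in> borel_measurable M" for n
    unfolding bil_avg_eq[abs_def] U_def[symmetric] by measurable
  obtain E where E [measurable]: "E \<in> sets M" and E_pos: "0 < prob E"
    and E_limsup: "AE x in M. x \<in> E \<longrightarrow> limsup (\<lambda>n. ereal (bil_avg M T f n x)) < \<infinity>"
    using assms(5) by blast
  \<comment> \<open>A finite upper limit of real numbers bounds the whole sequence, so the sets
    \<open>F K\<close> cover \<open>E\<close> up to a null set and one of them has positive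
    measure.\<close>
  define F where "F K = {x \<in> E. \<forall>n. bil_avg M T f n x \<le> real K}" for K :: nat
  have F [measurable]: "F K \<in> sets M" for K
    unfolding F_def by measurable
  have "\<exists>K. 0 < prob (F K)"
  proof (rule ccontr)
    assume "\<nexists>K. 0 < prob (F K)"
    then have "prob (F K) = 0" for K
      by (simp add: measure_le_0_iff not_less)
    then have "AE x in M. \<forall>K. x \<notin> F K"
      unfolding AE_all_countable by (simp add: prob_eq_0[OF F])
    with E_limsup have "AE x in M. x \<notin> E"
    proof eventually_elim
      case (elim x)
      show ?case
      proof
        assume "x \<in> E"
        then have "limsup (\<lambda>n. ereal (bil_avg M T f n x)) < \<infinity>"
          using elim by blast
        then obtain K :: nat where "limsup (\<lambda>n. ereal (bil_avg M T f n x)) < ereal K"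
          using less_PInf_Ex_of_nat by auto
        then have "\<forall>\<^sub>F n in sequentially. ereal (bil_avg M T f n x) < ereal K"
          by (rule Limsup_lessD)
        then obtain N where N: "\<And>n. N \<le> n \<Longrightarrow> bil_avg M T f n x < real K"
          by (auto simp: eventually_sequentially)
        obtain L :: nat where L: "Max ((\<lambda>n. bil_avg M T f n x) ` {..N}) < real L"
          using reals_Archimedean2 by blast
        have "bil_avg M T f n x \<le> real (max K L)" for n
        proof (cases "N \<le> n")
          case True
          then show ?thesis using N[of n] by simp
        next
          case False
          then have "bil_avg M T f n x \<le> Max ((\<lambda>n. bil_avg M T f n x) ` {..N})"
            by (intro Max_ge) auto
          then have "bil_avg M T f n x < real L"
            using L by (rule le_less_trans)
          then show ?thesis by simp
        qed
        then have "x \<in> F (max K L)"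
          using \<open>x \<in> E\<close> by (simp add: F_def)
        with elim show False by blast
      qed
    qed
    with E_pos show False
      by (simp add: prob_eq_0[OF E, symmetric])
  qed
  then obtain K where K: "0 < prob (F K)" ..
  \<comment> \<open>Subtracting the uniform bound makes all symmetric sums nonpositive on
    \<open>F K\<close>; \<open>K\<close> is added back to the limit at the end.\<close>
  define g where "g = (\<lambda>x. f x - real K)"
  have g [measurable]: "g \<in> borel_measurable M"
    unfolding g_def by measurable
  have nonpos: "(\<Sum>i\<in>{- int r..int r}. g (orbit T U i x)) \<le> 0" if "x \<in> F K" for x r
  proof -
    have "bil_avg M T f r x \<le> real K"
      using that by (simp add: F_def)
    then have "(\<Sum>i\<in>{- int r..int r}. f (orbit T U i x)) \<le> real K * real (2 * r + 1)"
      unfolding bil_avg_def Tpow_eq_orbit U_def[symmetric] by (subst (asm) pos_divide_le_eq) auto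
    then show ?thesis
      by (simp add: g_def sum_subtractf algebra_simps)
  qed
  have nonpos': "(\<Sum>i\<in>{- int r..int r}. g (orbit U T i x)) \<le> 0" if "x \<in> F K" for x r
    using nonpos[OF that, of r] by (simp add: symmetric_sum_eq add.commute)
  have "AE x in M. bdd_above (range (\<lambda>n. birkhoff_sum T g n x))"
    by (rule birkhoff_sum_bdd_above_of_symmetric_sums[OF F K nonpos])
  moreover have "AE x in M. bdd_above (range (\<lambda>n. birkhoff_sum U g n x))"
    by (rule inv.birkhoff_sum_bdd_above_of_symmetric_sums[OF F K nonpos'])
  ultimately obtain c :: ereal where c: "c \<noteq> \<infinity>"
    and lim: "AE x in M. (\<lambda>n. ereal (birkhoff_sum T g n x / n)) \<longlonglongrightarrow> c \<and>
                         (\<lambda>n. ereal (birkhoff_sum U g n x / n)) \<longlonglongrightarrow> c"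
    using averages_converge[OF g] by blast
  have f_lim: "(\<lambda>n. ereal (birkhoff_sum V f n x / n)) \<longlonglongrightarrow> c + ereal K"
    if "(\<lambda>n. ereal (birkhoff_sum V g n x / n)) \<longlonglongrightarrow> c" for V x
  proof -
    have "(\<lambda>n. ereal (birkhoff_sum V g n x / n) + ereal K) \<longlonglongrightarrow> c + ereal K"
      using that by (intro tendsto_add_ereal_general tendsto_const) auto
    \<comment> \<open>The equality fails at \<open>n = 0\<close> unless \<open>K = 0\<close>,
      because division by zero gives 0.\<close>
    moreover have "\<forall>\<^sub>F n in sequentially. ereal (birkhoff_sum V g n x / n) + ereal K = ereal (birkhoff_sum V f n x / n)"
      using eventually_gt_at_top[of 0]
      by eventually_elim (simp add: g_def birkhoff_sum_diff_const field_simps)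
    ultimately show ?thesis
      by (rule Lim_transform_eventually)
  qed
  have "c + ereal K \<noteq> \<infinity>"
    using c by simp
  moreover from lim have "AE x in M. (\<lambda>n. ereal (fwd_avg M T f n x)) \<longlonglongrightarrow> c + ereal K \<and>
                       (\<lambda>n. ereal (bwd_avg M T f n x)) \<longlonglongrightarrow> c + ereal K \<and>
                       (\<lambda>n. ereal (bil_avg M T f n x)) \<longlonglongrightarrow> c + ereal K"
  proof eventually_elim
    case (elim x)
    then have "(\<lambda>n. ereal (birkhoff_sum T f n x / n)) \<longlonglongrightarrow> c + ereal K"
      "(\<lambda>n. ereal (birkhoff_sum U f n x / n)) \<longlonglongrightarrow> c + ereal K"
      using f_lim by blast+
    then show ?case
      using bilateral_limit[of "\<lambda>n. birkhoff_sum T f n x" _ "\<lambda>n. birkhoff_sum U f n x" "f x"] c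
      by (simp add: fwd_avg_eq bwd_avg_eq bil_avg_eq U_def)
  qed
  ultimately show ?thesis by blast
qed

end
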